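(* For any integer $n\ge 0$, $|\mathfrak D^2_{2n}(2143)|=a_n a_{n+1}$, where for all $m\ge 0$ \[ a_{2m}=\frac{1}{2m+1}\binom{3m}{m},\qquad a_{2m+1}=\frac{1}{2m+1}\binom{3m+1}{m+1}=\frac{1}{m+1}\binom{3m+1}{m}. \]
   Context: A permutation $\sigma\in\mathfrak S_N$ contains a pattern $\tau\in\mathfrak S_k$ if there are positions $i_1<\dots<i_k$ such that $(\sigma(i_1),\dots,\sigma(i_k))$ is order-isomorphic to $\tau$; otherwise $\sigma$ avoids $\tau$. A Dumont permutation of the second kind is a permutation $\pi\in\mathfrak S_{2n}$ such that $\pi(2i)<2i$ and $\pi(2i-1)\ge 2i-1$ for every $i=1,\dots,n$. $\mathfrak D^2_{2n}$ is the set of these, and $\mathfrak D^2_{2n}(\tau)$ is the subset of those avoiding $\tau$. For $n=0$ the set consists of the empty permutation. *)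

theory Defs
  imports Complex_Main "HOL-Combinatorics.Permutations"
begin

text \<open>
  A permutation in S_N is a function \<open>\<sigma> :: nat \<Rightarrow> nat\<close> with \<open>\<sigma> permutes {1..N}\<close>; it is the identity
  outside \<open>{1..N}\<close>, so that distinct permutations are distinct functions.
\<close>

definition one_line :: "nat list \<Rightarrow> nat \<Rightarrow> nat" where
  "one_line xs j = (if j \<in> {1..length xs} then xs ! (j - 1) else j)"

text \<open>The function \<open>p\<close> lists the positions \<open>p 1 < \<dots> < p k\<close> of an occurrence.\<close>

definition contains_pattern :: "nat \<Rightarrow> (nat \<Rightarrow> nat) \<Rightarrow> nat \<Rightarrow> (nat \<Rightarrow> nat) \<Rightarrow> bool" where
  "contains_pattern N \<sigma> k \<tau> \<longleftrightarrow>
     (\<exists>p. p ` {1..k} \<subseteq> {1..N} \<and> strict_mono_on {1..k} p \<and>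
          (\<forall>a\<in>{1..k}. \<forall>b\<in>{1..k}. \<sigma> (p a) < \<sigma> (p b) \<longleftrightarrow> \<tau> a < \<tau> b))"

definition avoids_pattern :: "nat \<Rightarrow> (nat \<Rightarrow> nat) \<Rightarrow> nat \<Rightarrow> (nat \<Rightarrow> nat) \<Rightarrow> bool" where
  "avoids_pattern N \<sigma> k \<tau> \<longleftrightarrow> \<not> contains_pattern N \<sigma> k \<tau>"

definition dumont2 :: "nat \<Rightarrow> (nat \<Rightarrow> nat) set" where
  "dumont2 n = {\<pi>. \<pi> permutes {1..2 * n} \<and>
     (\<forall>i\<in>{1..n}. \<pi> (2 * i) < 2 * i \<and> \<pi> (2 * i - 1) \<ge> 2 * i - 1)}"

definition dumont2_avoiding :: "nat \<Rightarrow> nat \<Rightarrow> (nat \<Rightarrow> nat) \<Rightarrow> (nat \<Rightarrow> nat) set" where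
  "dumont2_avoiding n k \<tau> = {\<pi> \<in> dumont2 n. avoids_pattern (2 * n) \<pi> k \<tau>}"

definition a_seq :: "nat \<Rightarrow> real" where
  "a_seq n = (let m = n div 2 in
     if even n then 1 / real (2 * m + 1) * real ((3 * m) choose m)
     else 1 / real (2 * m + 1) * real ((3 * m + 1) choose (m + 1)))"

end

theory Submission
  imports Defs
begin

text \<open>
  Every pair of positions \<open>2 i - 1, 2 i\<close> is a descent of a Dumont permutation \<open>\<pi>\<close> of the second kind, so
  avoiding 2143 forces all entries at even positions to be smaller than all entries at odd
  positions. The even entries \<open>v\<close>, and the odd entries \<open>w\<close> read in the reverse complement, are then
  permutations of \<open>1, \<dots>, n\<close> that avoid 213 and satisfy \<open>v i < 2 i\<close> and \<open>w i \<le> 2 i\<close>. Conversely any two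
  such permutations combine: a descent of \<open>v\<close> comes too late, because the entry \<open>n\<close> of \<open>v\<close> precedes
  it, to be followed by a descent of the odd entries.

  A 213-avoider is \<open>k A B\<close> with \<open>A > k > B\<close>, which gives a recursion for the number of those with
  \<open>p i \<le> 2 i + c\<close> in which \<open>B\<close> is unrestricted and contributes a Catalan number. The generating function
  of the \<open>w\<close> is \<open>P / (1 - x P)\<close>, where \<open>P = C (x\<^sup>2 P)\<close> for the Catalan series \<open>C\<close>, that is
  \<open>P = 1 + x\<^sup>2 P\<^sup>3\<close>.
\<close>

section \<open>Raney numbers\<close>

text \<open>\<open>raney p n r\<close> is the coefficient of \<open>z^n\<close> in \<open>P^r\<close>, where \<open>P = 1 + z P^p\<close>.\<close>

fun raney :: "nat \<Rightarrow> nat \<Rightarrow> nat \<Rightarrow> nat" where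
  "raney p 0 r = 1"
| "raney p (Suc n) 0 = 0"
| "raney p (Suc n) (Suc r) = raney p (Suc n) r + raney p n (r + p)"

lemma raney_zero_right: "raney p n 0 = (if n = 0 then 1 else 0)"
  by (cases n) auto

text \<open>The coefficientwise form of \<open>P^(r+s) = P^r P^s\<close>.\<close>

lemma raney_convolution: "raney p n (r + s) = (\<Sum>i\<le>n. raney p i r * raney p (n - i) s)"
proof (induction p n r rule: raney.induct)
  case (1 p r)
  then show ?case by simp
next
  case (2 p n)
  then show ?case by (simp add: sum.atMost_Suc_shift del: sum.atMost_Suc)
next
  case (3 p n r)
  have "raney p (Suc n) (Suc r + s) = raney p (Suc n) (r + s) + raney p n (r + p + s)"
    by (simp add: ac_simps)
  also have "\<dots> = (\<Sum>i\<le>Suc n. raney p i (Suc r) * raney p (Suc n - i) s)"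
    unfolding "3.IH" by (simp add: sum.atMost_Suc_shift sum.distrib algebra_simps del: sum.atMost_Suc)
  finally show ?case .
qed

text \<open>If \<open>C = 1 + z C^p\<close> and \<open>P = 1 + z P^(p+1)\<close>, then \<open>P = C(z P)\<close>.\<close>

lemma raney_substitution:
  "(\<Sum>i\<le>n. raney p i q * raney (Suc p) (n - i) (r + i)) = raney (Suc p) n (r + q)"
proof (induction p n q arbitrary: r rule: raney.induct)
  case (1 p q)
  then show ?case by simp
next
  case (2 p n)
  then show ?case by (simp add: sum.atMost_Suc_shift del: sum.atMost_Suc)
next
  case (3 p n q)
  \<comment> \<open>Where the recursion lowers the first index, the summation index shifts by one
    and \<open>r + i\<close> becomes \<open>Suc r + i\<close>; this is why the induction keeps
    \<open>r\<close> arbitrary.\<close>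
  have "(\<Sum>i\<le>Suc n. raney p i (Suc q) * raney (Suc p) (Suc n - i) (r + i))
      = (\<Sum>i\<le>Suc n. raney p i q * raney (Suc p) (Suc n - i) (r + i))
        + (\<Sum>i\<le>n. raney p i (q + p) * raney (Suc p) (n - i) (Suc r + i))"
    by (simp add: sum.atMost_Suc_shift sum.distrib algebra_simps del: sum.atMost_Suc)
  also have "\<dots> = raney (Suc p) (Suc n) (r + q) + raney (Suc p) n (Suc r + (q + p))"
    unfolding "3.IH" ..
  also have "\<dots> = raney (Suc p) (Suc n) (r + Suc q)"
    by (simp add: ac_simps)
  finally show ?case .
qed

text \<open>This is the Fuss-Catalan formula with its denominator cleared. Both terms of the
  recursion have the same value \<open>M\<close> of \<open>p * n + r\<close>, so the induction
  reduces to an identity between multiples of \<open>M choose n\<close>.\<close>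

lemma raney_closed_form:
  assumes "p > 0"
  shows "(p * n + r) * raney p n r = r * ((p * n + r) choose n)"
  using assms
proof (induction p n r rule: raney.induct)
  case (1 p r)
  then show ?case by simp
next
  case (2 p n)
  then show ?case by simp
next
  case (3 p n r)
  define M where "M = p * Suc n + r"
  have IH1: "M * raney p (Suc n) r = r * (M choose Suc n)"
    using "3.IH"(1) "3.prems" by (simp add: M_def)
  have IH2: "M * raney p n (r + p) = (r + p) * (M choose n)"
    using "3.IH"(2) "3.prems" by (simp add: M_def ac_simps)
  have "M \<ge> n" "M > 0"
    using "3.prems" by (cases p; simp add: M_def)+
  have absorb: "Suc n * (M choose Suc n) = (M - n) * (M choose n)"
    unfolding binomial_absorption binomial_absorb_comp ..
  have pascal: "Suc n * (Suc M choose Suc n) = Suc M * (M choose n)"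
    by (rule Suc_times_binomial)
  have "Suc n * (M * (raney p (Suc n) r + raney p n (r + p)))
      = r * (Suc n * (M choose Suc n)) + Suc n * ((r + p) * (M choose n))"
    by (simp only: distrib_left IH1 IH2) (simp add: algebra_simps)
  also have "\<dots> = (r * (M - n) + Suc n * (r + p)) * (M choose n)"
    unfolding absorb by (simp add: algebra_simps)
  \<comment> \<open>The terms \<open>r * n\<close> cancel, and what remains besides
    \<open>r * M\<close> is \<open>p * Suc n + r\<close>, which is \<open>M\<close> again; so
    \<open>M\<close> can be cancelled below.\<close>
  also have "r * (M - n) + Suc n * (r + p) = r * M + M"
  proof -
    have "r * (M - n) + r * n = r * M"
      using \<open>M \<ge> n\<close> by (metis distrib_left le_add_diff_inverse2)
    then show ?thesis
      by (simp add: M_def algebra_simps)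
  qed
  finally have "M * (Suc n * (raney p (Suc n) r + raney p n (r + p))) = M * (Suc r * (M choose n))"
    by (simp add: algebra_simps)
  then have eq: "Suc n * raney p (Suc n) (Suc r) = Suc r * (M choose n)"
    using \<open>M > 0\<close> by (simp only: mult_cancel1) simp
  have "Suc n * (Suc M * raney p (Suc n) (Suc r)) = Suc n * (Suc r * (Suc M choose Suc n))"
    using eq pascal by (metis mult.left_commute)
  then have "Suc M * raney p (Suc n) (Suc r) = Suc r * (Suc M choose Suc n)"
    by (simp only: mult_cancel1) simp
  then show ?case
    by (simp add: M_def del: raney.simps binomial_Suc_Suc)
qed

section \<open>Identification of \<open>a_seq\<close> with Raney numbers for
  \<open>p = 3\<close>\<close>

text \<open>The closed form has denominator \<open>3 * m + 1\<close>; absorbing it into the binomial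
  coefficient replaces it by \<open>2 * m + 1\<close>.\<close>

lemma a_seq_even: "a_seq (2 * m) = raney 3 m 1"
proof -
  have "(3 * m + 1) * raney 3 m 1 = (3 * m + 1) choose m"
    using raney_closed_form[of 3 m 1] by simp
  moreover have "(2 * m + 1) * ((3 * m + 1) choose m) = (3 * m + 1) * ((3 * m) choose m)"
    using binomial_absorb_comp[of "3 * m + 1" m] by simp
  ultimately have "(3 * m + 1) * ((2 * m + 1) * raney 3 m 1) = (3 * m + 1) * ((3 * m) choose m)"
    by (metis mult.left_commute)
  then have "(2 * m + 1) * raney 3 m 1 = (3 * m) choose m"
    by (simp only: mult_cancel1) simp
  then have "real (2 * m + 1) * real (raney 3 m 1) = real ((3 * m) choose m)"
    by (metis of_nat_mult)
  then show ?thesis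
    by (simp add: a_seq_def field_simps)
qed

lemma a_seq_odd_alt: "a_seq (2 * m + 1) = 1 / real (m + 1) * real ((3 * m + 1) choose m)"
proof -
  have "(m + 1) * ((3 * m + 1) choose (m + 1)) = (2 * m + 1) * ((3 * m + 1) choose m)"
    using binomial_absorb_comp[of "3 * m + 1" m] binomial_absorption[of m "3 * m + 1"] by simp
  then have "real (m + 1) * real ((3 * m + 1) choose (m + 1)) = real (2 * m + 1) * real ((3 * m + 1) choose m)"
    by (metis of_nat_mult)
  then show ?thesis
    by (simp add: a_seq_def field_simps)
qed

lemma a_seq_odd: "a_seq (2 * m + 1) = raney 3 m 2"
proof -
  have "(3 * m + 2) * raney 3 m 2 = 2 * ((3 * m + 2) choose m)"
    using raney_closed_form[of 3 m 2] by simp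
  moreover have "(2 * m + 2) * ((3 * m + 2) choose m) = (3 * m + 2) * ((3 * m + 1) choose m)"
    using binomial_absorb_comp[of "3 * m + 2" m] by simp
  ultimately have "(3 * m + 2) * ((m + 1) * raney 3 m 2) = (3 * m + 2) * ((3 * m + 1) choose m)"
    by (simp add: algebra_simps)
  then have "(m + 1) * raney 3 m 2 = (3 * m + 1) choose m"
    by (simp only: mult_cancel1) simp
  then have eq: "real ((3 * m + 1) choose m) = real (m + 1) * real (raney 3 m 2)"
    by (metis of_nat_mult)
  show ?thesis
    unfolding a_seq_odd_alt eq by simp
qed

text \<open>Both parities in the single form that the count produces later. For odd \<open>n\<close>
  the term \<open>raney 3 (Suc m) 0\<close> vanishes, so
  \<open>raney 3 (Suc m) 1 = raney 3 m 3\<close>.\<close>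

lemma a_seq_Suc: "a_seq (Suc n) = raney 3 (n div 2) (n mod 2 + 2)"
proof (cases "even n")
  case True
  then obtain m where m: "n = 2 * m" by blast
  then have "n div 2 = m" "n mod 2 + 2 = 2" by auto
  with m show ?thesis using a_seq_odd[of m] by (simp only: Suc_eq_plus1)
next
  case False
  then obtain m where m: "n = 2 * m + 1" by (elim oddE)
  have "a_seq (2 * Suc m) = raney 3 (Suc m) (Suc 0)"
    using a_seq_even[of "Suc m"] by simp
  also have "raney 3 (Suc m) (Suc 0) = raney 3 m 3"
    by simp
  finally have "a_seq (2 * Suc m) = raney 3 m 3" .
  moreover have "2 * Suc m = Suc n" "n div 2 = m" "n mod 2 + 2 = 3"
    using m by simp_all
  ultimately show ?thesis by (simp only:)
qed

section \<open>Permutations avoiding 213 with linearly bounded entries\<close>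

text \<open>Recursion on the head, which plays the letter 2, makes splitting off the first entry
  immediate; \<open>avoids_213_iff\<close> gives the form by positions.\<close>

fun avoids_213 :: "nat list \<Rightarrow> bool" where
  "avoids_213 [] \<longleftrightarrow> True"
| "avoids_213 (x # xs) \<longleftrightarrow> sorted_wrt (\<lambda>y z. y < x \<longrightarrow> z \<le> x) xs \<and> avoids_213 xs"

lemma avoids_213_iff:
  "avoids_213 xs \<longleftrightarrow>
     (\<forall>i j l. i < j \<longrightarrow> j < l \<longrightarrow> l < length xs \<longrightarrow> \<not> (xs ! j < xs ! i \<and> xs ! i < xs ! l))"
proof (induction xs)
  case Nil
  then show ?case by simp
next
  case (Cons x xs)
  show ?case (is "_ \<longleftrightarrow> (\<forall>i j l. ?Q i j l)")
  proof
    assume L: "avoids_213 (x # xs)"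
    show "\<forall>i j l. ?Q i j l"
    proof (intro allI impI)
      fix i j l assume *: "i < j" "j < l" "l < length (x # xs)"
      then obtain j' l' where [simp]: "j = Suc j'" "l = Suc l'"
        by (metis Suc_pred gr_implies_not0 neq0_conv)
      show "\<not> ((x # xs) ! j < (x # xs) ! i \<and> (x # xs) ! i < (x # xs) ! l)"
      proof (cases i)
        case 0
        have "xs ! j' < x \<longrightarrow> xs ! l' \<le> x"
          using L * by (intro sorted_wrt_nth_less[of "\<lambda>y z. y < x \<longrightarrow> z \<le> x" xs]) auto
        with 0 show ?thesis by auto
      next
        case (Suc i')
        with L * Cons.IH show ?thesis by auto
      qed
    qed
  next
    assume R: "\<forall>i j l. ?Q i j l"
    have "sorted_wrt (\<lambda>y z. y < x \<longrightarrow> z \<le> x) xs"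
      unfolding sorted_wrt_iff_nth_less
    proof (intro allI impI)
      fix j l assume "j < l" "l < length xs" "xs ! j < x"
      with R[rule_format, of 0 "Suc j" "Suc l"] show "xs ! l \<le> x" by auto
    qed
    moreover have "avoids_213 xs"
      unfolding Cons.IH
    proof (intro allI impI)
      fix i j l assume "i < j" "j < l" "l < length xs"
      with R[rule_format, of "Suc i" "Suc j" "Suc l"]
      show "\<not> (xs ! j < xs ! i \<and> xs ! i < xs ! l)" by auto
    qed
    ultimately show "avoids_213 (x # xs)" by simp
  qed
qed

text \<open>The last letter of 213 is the largest, so an occurrence cannot begin in \<open>A\<close>
  and end in \<open>B\<close>.\<close>

lemma avoids_213_append_decreasing:
  assumes "\<forall>a\<in>set A. \<forall>b\<in>set B. b < a"
  shows "avoids_213 (A @ B) \<longleftrightarrow> avoids_213 A \<and> avoids_213 B"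
  using assms
proof (induction A)
  case Nil
  then show ?case by simp
next
  case (Cons a A)
  have "sorted_wrt (\<lambda>y z. y < a \<longrightarrow> z \<le> a) B"
    using Cons.prems by (auto simp: sorted_wrt_iff_nth_less less_imp_le)
  with Cons show ?case
    by (auto simp: sorted_wrt_append less_imp_le)
qed

lemma avoids_213_map_add: "avoids_213 (map ((+) k) A) \<longleftrightarrow> avoids_213 A"
  by (induction A) (auto simp: sorted_wrt_map)

text \<open>Once an entry below \<open>x\<close> has occurred, no later one exceeds
  \<open>x\<close>; hence the entries above \<open>x\<close> form an initial segment.\<close>

lemma partition_by_first_entry:
  fixes xs :: "nat list"
  assumes "sorted_wrt (\<lambda>y z. y < x \<longrightarrow> z \<le> x) xs" "x \<notin> set xs"
  shows "filter (\<lambda>y. x < y) xs @ filter (\<lambda>y. y < x) xs = xs"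
  using assms
proof (induction xs)
  case Nil
  then show ?case by simp
next
  case (Cons a xs)
  show ?case
  proof (cases "a < x")
    case True
    then have "\<forall>y\<in>set xs. y < x"
      using Cons.prems by (metis le_neq_implies_less list.set_intros(2) sorted_wrt.simps(2))
    then have "filter (\<lambda>y. x < y) xs = []" "filter (\<lambda>y. y < x) xs = xs"
      by (auto simp: filter_empty_conv filter_id_conv)
    with True show ?thesis by simp
  next
    case False
    with Cons show ?thesis by auto
  qed
qed

section \<open>Decomposition of bounded 213-avoiders at the first entry\<close>

text \<open>As lists are indexed from 0, \<open>d = 1\<close> encodes \<open>v i < 2 i\<close> and
  \<open>d = 2\<close> encodes \<open>w i \<le> 2 i\<close> for indices starting at 1.\<close>

definition bounded_213 :: "nat \<Rightarrow> nat \<Rightarrow> nat list set" where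
  "bounded_213 n d =
     {xs. distinct xs \<and> set xs = {1..n} \<and> avoids_213 xs \<and> (\<forall>i<n. xs ! i \<le> 2 * i + d)}"

lemma bounded_213_length: "xs \<in> bounded_213 n d \<Longrightarrow> length xs = n"
  unfolding bounded_213_def using distinct_card[of xs] by simp

lemma finite_bounded_213: "finite (bounded_213 n d)"
proof (rule finite_subset)
  show "bounded_213 n d \<subseteq> {xs. set xs \<subseteq> {1..n} \<and> length xs = n}"
    using bounded_213_length by (auto simp: bounded_213_def)
qed (auto intro: finite_lists_length_eq)

lemma bounded_213_0: "bounded_213 0 d = {[]}"
  by (auto simp: bounded_213_def)

text \<open>The bound is vacuous once \<open>d \<ge> n\<close>, so \<open>bounded_213 n n\<close>
  serves as the set of all 213-avoiders of size \<open>n\<close>.\<close>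

lemma bounded_213_cong:
  assumes "n \<le> d"
  shows "bounded_213 n d = bounded_213 n n"
proof -
  have "xs ! i \<le> n" if "distinct xs" "set xs = {1..n}" "i < n" for xs i
  proof -
    have "length xs = n" using that distinct_card[of xs] by simp
    with that nth_mem[of i xs] show ?thesis by auto
  qed
  then have "xs ! i \<le> 2 * i + e" if "distinct xs" "set xs = {1..n}" "i < n" "n \<le> e" for xs i e
    using that by (meson le_trans trans_le_add2)
  with assms show ?thesis
    unfolding bounded_213_def by (auto simp only: order_refl)
qed

definition glue :: "nat \<Rightarrow> nat list \<times> nat list \<Rightarrow> nat list" where
  "glue s AB = Suc s # map ((+) (Suc s)) (fst AB) @ snd AB"

lemma sorted_wrt_if_all: "(\<And>y z. y \<in> set xs \<Longrightarrow> z \<in> set xs \<Longrightarrow> P y z) \<Longrightarrow> sorted_wrt P xs"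
  by (simp add: sorted_wrt_iff_nth_less)

text \<open>The head meets its bound because \<open>s < d\<close>. Entries of \<open>A\<close> move
  one place to the right and up by \<open>Suc s\<close>, which turns
  \<open>2 * j + (d + 1 - s)\<close> into \<open>2 * (j + 1) + d\<close>. Entries of
  \<open>B\<close> are at most \<open>s\<close>, hence below \<open>d\<close> wherever they
  stand.\<close>

lemma glue_in_bounded_213:
  assumes "s \<le> n" "s < d" "A \<in> bounded_213 (n - s) (d + 1 - s)" "B \<in> bounded_213 s s"
  shows "glue s (A, B) \<in> bounded_213 (Suc n) d"
proof -
  have len: "length A = n - s" "length B = s"
    using assms bounded_213_length by auto
  have A: "distinct A" "set A = {1..n - s}" "avoids_213 A" "\<And>i. i < n - s \<Longrightarrow> A ! i \<le> 2 * i + (d + 1 - s)"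
    and B: "distinct B" "set B = {1..s}" "avoids_213 B"
    using assms by (auto simp: bounded_213_def)
  let ?A = "map ((+) (Suc s)) A"
  have setA: "set ?A = {s + 2..Suc n}"
    unfolding set_map A(2) image_add_atLeastAtMost using assms(1) by simp
  have "distinct (glue s (A, B))"
    using A(1) B(1) setA B(2) by (auto simp: glue_def distinct_map simp del: set_map)
  moreover have "set (glue s (A, B)) = {1..Suc n}"
    using setA B(2) assms(1) by (auto simp: glue_def simp del: set_map)
  moreover have "avoids_213 (glue s (A, B))"
  proof -
    have "avoids_213 (?A @ B)"
      using setA B(2,3) A(3)
      by (subst avoids_213_append_decreasing) (auto simp: avoids_213_map_add simp del: set_map)
    moreover have "sorted_wrt (\<lambda>y z. y < Suc s \<longrightarrow> z \<le> Suc s) (?A @ B)"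
      unfolding sorted_wrt_append setA B(2)
      by (intro conjI sorted_wrt_if_all) (simp_all add: setA B(2) del: set_map)
    ultimately show ?thesis by (simp add: glue_def)
  qed
  moreover have "glue s (A, B) ! i \<le> 2 * i + d" if "i < Suc n" for i
  proof (cases i)
    case 0
    with assms(2) show ?thesis by (simp add: glue_def)
  next
    case (Suc j)
    show ?thesis
    proof (cases "j < n - s")
      case True
      with A(4)[of j] assms(2) Suc len show ?thesis by (simp add: glue_def nth_append)
    next
      case False
      then have "B ! (j - (n - s)) \<in> set B"
        using that Suc len by (intro nth_mem) auto
      with False Suc B(2) assms(2) len show ?thesis by (auto simp: glue_def nth_append)
    qed
  qed
  ultimately show ?thesis by (simp add: bounded_213_def)
qed

lemma bounded_213_Suc_cases:
  assumes xs: "xs \<in> bounded_213 (Suc n) d"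
  obtains s A B where "s \<le> n" "s < d" "A \<in> bounded_213 (n - s) (d + 1 - s)" "B \<in> bounded_213 s s"
    "xs = glue s (A, B)"
proof -
  have props: "distinct xs" "set xs = {1..Suc n}" "avoids_213 xs"
    "\<And>i. i < Suc n \<Longrightarrow> xs ! i \<le> 2 * i + d" and len: "length xs = Suc n"
    using xs bounded_213_length[OF xs] by (auto simp: bounded_213_def)
  then obtain x ys where cons: "xs = x # ys"
    by (metis length_Suc_conv)
  then have "x \<in> {1..Suc n}" using props(2) by auto
  then obtain s where s: "x = Suc s" "s \<le> n"
    by (cases x) auto
  have "s < d" using props(4)[of 0] cons s by simp
  define A' where "A' = filter (\<lambda>y. x < y) ys"
  define B where "B = filter (\<lambda>y. y < x) ys"
  have xys: "x \<notin> set ys" using props(1) cons by simp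
  then have ys: "ys = A' @ B"
    using partition_by_first_entry[of x ys] props(3) cons by (simp add: A'_def B_def)
  have set_ys: "set ys = {1..Suc n} - {x}" using props(1,2) cons by auto
  have setA': "set A' = {s + 2..Suc n}" and setB: "set B = {1..s}"
    unfolding A'_def B_def set_filter set_ys s(1) using s(2) by auto
  \<comment> \<open>The truncated subtraction is exact, since all entries of \<open>A'\<close> are
    at least \<open>s + 2\<close>.\<close>
  define A where "A = map (\<lambda>y. y - Suc s) A'"
  have A': "A' = map ((+) (Suc s)) A"
    unfolding A_def map_map using setA' by (intro map_idI[symmetric]) auto
  have dist: "distinct A'" "distinct B" using props(1) cons ys by auto
  have av: "avoids_213 A'" "avoids_213 B"
  proof -
    have "avoids_213 (A' @ B)" using props(3) cons ys by simp
    then show "avoids_213 A'" "avoids_213 B"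
      using avoids_213_append_decreasing[of A' B] setA' setB by auto
  qed
  have setA: "set A = {1..n - s}"
  proof -
    have "set A = (\<lambda>y. y - Suc s) ` {s + 2..Suc n}"
      by (simp add: A_def setA')
    also have "\<dots> = {1..n - s}"
    proof (intro equalityI subsetI)
      fix y assume "y \<in> {1..n - s}"
      then show "y \<in> (\<lambda>y. y - Suc s) ` {s + 2..Suc n}"
        by (intro image_eqI[of _ _ "y + Suc s"]) auto
    qed auto
    finally show ?thesis .
  qed
  have distA: "distinct A" using dist(1) unfolding A' by (simp add: distinct_map)
  have lenA: "length A = n - s" using distA setA distinct_card[of A] by simp
  have bound: "A ! i \<le> 2 * i + (d + 1 - s)" if "i < n - s" for i
  proof -
    have "A ! i + Suc s \<le> 2 * Suc i + d"
      using props(4)[of "Suc i"] that lenA by (simp add: cons ys A' nth_append algebra_simps)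
    with \<open>s < d\<close> show ?thesis by simp
  qed
  have "A \<in> bounded_213 (n - s) (d + 1 - s)"
    using distA setA av(1) bound unfolding A' avoids_213_map_add by (simp add: bounded_213_def)
  moreover have "B \<in> bounded_213 s s"
  proof -
    have "B ! i \<le> 2 * i + s" if "i < s" for i
    proof -
      have "length B = s" using dist(2) setB distinct_card[of B] by simp
      then have "B ! i \<in> set B" using that by simp
      then show ?thesis using setB by simp
    qed
    with dist(2) setB av(2) show ?thesis by (simp add: bounded_213_def)
  qed
  moreover have "xs = glue s (A, B)"
    by (simp add: glue_def cons ys A' s)
  ultimately show ?thesis using that s \<open>s < d\<close> by blast
qed

lemma inj_on_glue: "inj_on (glue s) (bounded_213 m d \<times> C)"
proof (intro inj_onI, elim SigmaE)
  fix x y A A' B B'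
  assume eq: "glue s x = glue s y" and xy: "x = (A, B)" "y = (A', B')"
    and "A \<in> bounded_213 m d" "A' \<in> bounded_213 m d"
  then have len: "length A = length A'"
    by (simp only: bounded_213_length[of _ m d])
  from eq show "x = y"
    unfolding xy glue_def by (simp add: len)
qed

text \<open>The head of a glued list determines \<open>s\<close>, and \<open>s\<close> determines
  the length of \<open>A\<close>, so every list arises exactly once.\<close>

lemma card_bounded_213_Suc:
  "card (bounded_213 (Suc n) d) =
     (\<Sum>s | s \<le> n \<and> s < d. card (bounded_213 s s) * card (bounded_213 (n - s) (d + 1 - s)))"
proof -
  let ?I = "{s. s \<le> n \<and> s < d}"
  let ?X = "\<lambda>s. bounded_213 (n - s) (d + 1 - s) \<times> bounded_213 s s"
  have decomp: "bounded_213 (Suc n) d = (\<Union>s\<in>?I. glue s ` ?X s)"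
  proof (intro equalityI subsetI)
    fix xs assume "xs \<in> bounded_213 (Suc n) d"
    then obtain s A B where "s \<in> ?I" "(A, B) \<in> ?X s" "xs = glue s (A, B)"
      by (rule bounded_213_Suc_cases) simp
    then show "xs \<in> (\<Union>s\<in>?I. glue s ` ?X s)"
      by (intro UN_I image_eqI)
  next
    fix xs assume "xs \<in> (\<Union>s\<in>?I. glue s ` ?X s)"
    then obtain s A B where "s \<in> ?I" "(A, B) \<in> ?X s" "xs = glue s (A, B)"
      by (elim UN_E imageE SigmaE) simp
    then show "xs \<in> bounded_213 (Suc n) d"
      by (simp add: glue_in_bounded_213)
  qed
  have "card (bounded_213 (Suc n) d) = (\<Sum>s\<in>?I. card (glue s ` ?X s))"
    unfolding decomp
  proof (rule card_UN_disjoint)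
    show "finite ?I" by simp
    show "\<forall>s\<in>?I. finite (glue s ` ?X s)"
      by (simp add: finite_bounded_213)
    have "glue s x \<noteq> glue t y" if "s \<noteq> t" for s t x y
      using that by (simp add: glue_def)
    then show "\<forall>s\<in>?I. \<forall>t\<in>?I. s \<noteq> t \<longrightarrow> glue s ` ?X s \<inter> glue t ` ?X t = {}"
      by blast
  qed
  also have "\<dots> = (\<Sum>s\<in>?I. card (?X s))"
    by (rule sum.cong[OF refl], rule card_image, rule inj_on_glue)
  finally show ?thesis
    unfolding card_cartesian_product by (simp only: mult.commute)
qed

section \<open>Solution of the recursion\<close>

text \<open>With a vacuous bound the recursion is the Catalan recursion; \<open>raney 2 n 1\<close>
  is the Catalan number.\<close>

lemma card_213_avoiders: "card (bounded_213 n n) = raney 2 n 1"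
proof (induction n rule: less_induct)
  case (less n)
  show ?case
  proof (cases n)
    case 0
    then show ?thesis by (simp add: bounded_213_0)
  next
    case (Suc m)
    have "card (bounded_213 n n) =
        (\<Sum>s | s \<le> m \<and> s < n. card (bounded_213 s s) * card (bounded_213 (m - s) (n + 1 - s)))"
      unfolding Suc by (rule card_bounded_213_Suc)
    also have "\<dots> = (\<Sum>s\<le>m. raney 2 s 1 * raney 2 (m - s) 1)"
    proof (intro sum.cong)
      fix s assume "s \<in> {..m}"
      then show "card (bounded_213 s s) * card (bounded_213 (m - s) (n + 1 - s))
          = raney 2 s 1 * raney 2 (m - s) 1"
        using less[of s] less[of "m - s"] bounded_213_cong[of "m - s" "n + 1 - s"] Suc by simp
    qed (auto simp: Suc)
    also have "\<dots> = raney 2 m (1 + 1)"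
      by (rule raney_convolution[symmetric])
    also have "\<dots> = raney 2 n 1"
      by (simp add: Suc numeral_2_eq_2)
    finally show ?thesis .
  qed
qed

text \<open>
  Iterating the recursion \<open>k\<close> times weights the remaining problem by the number \<open>raney 3 j (k + 1 - j)\<close>
  of ways to have spent \<open>j\<close> entries on the final segments; for \<open>j > k\<close> this weight is
  \<open>raney 3 j 0 = 0\<close>.
\<close>

lemma card_bounded_213_iterated:
  "(\<Sum>j\<le>m. raney 3 j (k + 1 - j) * card (bounded_213 (m - j) (k + 2 - j)))
     = raney 3 (min m ((k + m) div 2)) (k + m - 2 * min m ((k + m) div 2) + 2)"
proof (induction m arbitrary: k)
  case 0
  then show ?case by (simp add: bounded_213_0)
next
  case (Suc m)
  let ?f = "\<lambda>n d. card (bounded_213 n d)"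
  define N where "N = min m (k + 1)"
  \<comment> \<open>Beyond \<open>N\<close> the weight is \<open>raney 3 j 0 = 0\<close>. Up to
    \<open>N\<close> the differences \<open>m - j\<close> and \<open>k + 1 - j\<close> are
    exact.\<close>
  have "(\<Sum>j\<le>m. raney 3 j (k + 1 - j) * ?f (Suc m - j) (k + 2 - j))
      = (\<Sum>j\<le>N. raney 3 j (k + 1 - j) * ?f (Suc m - j) (k + 2 - j))"
    by (rule sum.mono_neutral_right) (auto simp: N_def raney_zero_right)
  also have "\<dots> = (\<Sum>j\<le>N. \<Sum>s\<le>N - j. raney 3 j (k + 1 - j)
      * (raney 2 s 1 * ?f (m - (j + s)) (k + 3 - (j + s))))"
  proof (rule sum.cong[OF refl])
    fix j assume "j \<in> {..N}"
    then have j: "j \<le> m" "j \<le> k + 1" by (auto simp: N_def)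
    have "{s. s \<le> m - j \<and> s < k + 2 - j} = {..N - j}"
      using j by (auto simp: N_def)
    then have "?f (Suc (m - j)) (k + 2 - j) =
        (\<Sum>s\<le>N - j. raney 2 s 1 * ?f (m - j - s) (k + 2 - j + 1 - s))"
      unfolding card_bounded_213_Suc card_213_avoiders by (rule arg_cong)
    also have "\<dots> = (\<Sum>s\<le>N - j. raney 2 s 1 * ?f (m - (j + s)) (k + 3 - (j + s)))"
    proof -
      have "m - j - s = m - (j + s)" "k + 2 - j + 1 - s = k + 3 - (j + s)" for s
        using j by auto
      then show ?thesis by (simp only:)
    qed
    finally show "raney 3 j (k + 1 - j) * ?f (Suc m - j) (k + 2 - j) =
        (\<Sum>s\<le>N - j. raney 3 j (k + 1 - j) * (raney 2 s 1 * ?f (m - (j + s)) (k + 3 - (j + s))))"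
      using j by (simp add: Suc_diff_le sum_distrib_left)
  qed
  \<comment> \<open>The new index \<open>l = j + s\<close> counts all entries spent on final
    segments, including the latest one.\<close>
  also have "\<dots> = (\<Sum>l\<le>N. \<Sum>s\<le>l. raney 3 (l - s) (k + 1 - (l - s))
      * (raney 2 s 1 * ?f (m - l) (k + 3 - l)))"
    unfolding sum.Sigma[OF finite_atMost ballI[OF finite_atMost]]
    by (rule sum.reindex_bij_witness[of _ "\<lambda>(l, s). (l - s, s)" "\<lambda>(j, s). (j + s, s)"]) auto
  also have "\<dots> = (\<Sum>l\<le>N. raney 3 l (k + 2 - l) * ?f (m - l) (k + 3 - l))"
  proof (rule sum.cong[OF refl])
    fix l assume "l \<in> {..N}"
    then have l: "l \<le> k + 1" by (auto simp: N_def)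
    \<comment> \<open>Here \<open>k + 1 - (l - s) = (k + 1 - l) + s\<close>, so
      \<open>raney_substitution\<close> applies with \<open>p = 2\<close>, \<open>q = 1\<close>,
      \<open>r = k + 1 - l\<close> and yields the weight belonging to \<open>Suc k\<close>.\<close>
    have "(\<Sum>s\<le>l. raney 3 (l - s) (k + 1 - (l - s)) * (raney 2 s 1 * ?f (m - l) (k + 3 - l)))
        = (\<Sum>s\<le>l. raney 2 s 1 * raney (Suc 2) (l - s) ((k + 1 - l) + s)) * ?f (m - l) (k + 3 - l)"
      unfolding sum_distrib_right using l by (intro sum.cong) auto
    also have "\<dots> = raney 3 l (k + 2 - l) * ?f (m - l) (k + 3 - l)"
      unfolding raney_substitution using l by (simp add: Suc_diff_le)
    finally show "(\<Sum>s\<le>l. raney 3 (l - s) (k + 1 - (l - s)) * (raney 2 s 1 * ?f (m - l) (k + 3 - l)))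
        = raney 3 l (k + 2 - l) * ?f (m - l) (k + 3 - l)" .
  qed
  also have "\<dots> = (\<Sum>l\<le>m. raney 3 l (Suc k + 1 - l) * ?f (m - l) (Suc k + 2 - l))"
  proof -
    have "Suc k + 1 - l = k + 2 - l" "Suc k + 2 - l = k + 3 - l" for l by simp_all
    then show ?thesis
      by (simp only:) (rule sum.mono_neutral_left, auto simp: N_def raney_zero_right)
  qed
  also have "\<dots> = raney 3 (min m ((k + Suc m) div 2)) (k + Suc m - 2 * min m ((k + Suc m) div 2) + 2)"
    unfolding Suc.IH by simp
  finally have step: "(\<Sum>j\<le>m. raney 3 j (k + 1 - j) * ?f (Suc m - j) (k + 2 - j)) = \<dots>" .
  \<comment> \<open>The term \<open>j = Suc m\<close>, left out so far, contributes its weight times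
    1 for the empty list.\<close>
  have "(\<Sum>j\<le>Suc m. raney 3 j (k + 1 - j) * ?f (Suc m - j) (k + 2 - j))
      = raney 3 (min m ((k + Suc m) div 2)) (k + Suc m - 2 * min m ((k + Suc m) div 2) + 2)
        + raney 3 (Suc m) (k - m)"
    using step by (simp add: bounded_213_0)
  \<comment> \<open>If \<open>Suc m \<le> k\<close>, the two summands merge by the defining
    recursion of \<open>raney\<close>. Otherwise the second one is
    \<open>raney 3 (Suc m) 0 = 0\<close> and the two minima agree.\<close>
  also have "\<dots> = raney 3 (min (Suc m) ((k + Suc m) div 2))
      (k + Suc m - 2 * min (Suc m) ((k + Suc m) div 2) + 2)"
  proof (cases "Suc m \<le> k")
    case True
    then obtain r where k: "k = Suc m + r" by (auto simp: le_iff_add)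
    have "min m ((k + Suc m) div 2) = m" "min (Suc m) ((k + Suc m) div 2) = Suc m"
      by (auto simp: k)
    moreover have "k + Suc m - 2 * m + 2 = r + 1 + 3" "k - m = r + 1" "k + Suc m - 2 * Suc m + 2 = Suc (r + 1)"
      by (simp_all add: k)
    ultimately show ?thesis by (simp only: raney.simps(3) add.commute)
  next
    case False
    then have "min m ((k + Suc m) div 2) = min (Suc m) ((k + Suc m) div 2)" by auto
    with False show ?thesis by simp
  qed
  finally show ?case .
qed

text \<open>For \<open>k = 0\<close> only \<open>j = 0\<close> has nonzero weight, so the iterated
  sum collapses to the desired cardinality.\<close>

lemma card_bounded_213_2: "card (bounded_213 n 2) = a_seq (Suc n)"
proof -
  have "card (bounded_213 n 2) = (\<Sum>j\<in>{0}. raney 3 j (0 + 1 - j) * card (bounded_213 (n - j) (0 + 2 - j)))"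
    by (simp only: sum.insert sum.empty finite.emptyI empty_iff raney.simps add_0 add_0_right diff_zero mult_1 not_False_eq_True)
  also have "\<dots> = (\<Sum>j\<le>n. raney 3 j (0 + 1 - j) * card (bounded_213 (n - j) (0 + 2 - j)))"
    by (rule sum.mono_neutral_left) (auto simp: raney_zero_right)
  also have "\<dots> = raney 3 (n div 2) (n mod 2 + 2)"
  proof -
    have "min n (n div 2) = n div 2" by simp
    then show ?thesis
      unfolding card_bounded_213_iterated by (simp only: add_0 minus_mult_div_eq_mod)
  qed
  finally show ?thesis by (simp add: a_seq_Suc)
qed

text \<open>The bound forces the first entry to be 1; deleting it leaves a list with
  \<open>d = 2\<close>.\<close>

lemma card_bounded_213_1: "card (bounded_213 n 1) = a_seq n"
proof (cases n)
  case 0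
  then show ?thesis by (simp add: bounded_213_0 a_seq_def)
next
  case (Suc m)
  have "{s. s \<le> m \<and> s < 1} = {0::nat}" by auto
  then have "card (bounded_213 (Suc m) 1) = card (bounded_213 m 2)"
    unfolding card_bounded_213_Suc by (simp add: bounded_213_0 numeral_2_eq_2)
  then show ?thesis using card_bounded_213_2 Suc by simp
qed

section \<open>Dumont permutations of the second kind avoiding 2143\<close>

lemma contains_2143_iff:
  "contains_pattern N \<sigma> 4 (one_line [2, 1, 4, 3]) \<longleftrightarrow>
     (\<exists>a b c d. 1 \<le> a \<and> a < b \<and> b < c \<and> c < d \<and> d \<le> N \<and> \<sigma> b < \<sigma> a \<and> \<sigma> a < \<sigma> d \<and> \<sigma> d < \<sigma> c)"
    (is "?L \<longleftrightarrow> ?R")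
proof
  let ?t = "one_line [2, 1, 4, 3]"
  have t: "?t 1 = 2" "?t 2 = 1" "?t 3 = 4" "?t 4 = 3"
    by (simp_all add: one_line_def)
  have I: "{1..4} = {1, 2, 3, 4 :: nat}" by auto
  {
    assume ?L
    then obtain p where p: "p ` {1..4} \<subseteq> {1..N}" and mono: "strict_mono_on {1..4} p"
      and order: "\<forall>a\<in>{1..4}. \<forall>b\<in>{1..4}. \<sigma> (p a) < \<sigma> (p b) \<longleftrightarrow> ?t a < ?t b"
      unfolding contains_pattern_def by blast
    have "p 1 < p 2" "p 2 < p 3" "p 3 < p 4"
      by (rule strict_mono_onD[OF mono]; simp)+
    moreover have "p 1 \<in> {1..N}" "p 4 \<in> {1..N}"
      by (rule subsetD[OF p], simp)+
    then have "1 \<le> p 1" "p 4 \<le> N" by simp_all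
    moreover have "\<sigma> (p 2) < \<sigma> (p 1)" "\<sigma> (p 1) < \<sigma> (p 4)" "\<sigma> (p 4) < \<sigma> (p 3)"
      using order[unfolded I] by (simp_all add: t[unfolded One_nat_def])
    ultimately show ?R by blast
  next
    assume ?R
    then obtain a b c d where *: "1 \<le> a" "a < b" "b < c" "c < d" "d \<le> N"
      "\<sigma> b < \<sigma> a" "\<sigma> a < \<sigma> d" "\<sigma> d < \<sigma> c" by blast
    define p :: "nat \<Rightarrow> nat" where
      "p i = (if i = 1 then a else if i = 2 then b else if i = 3 then c else d)" for i
    have p: "p 1 = a" "p 2 = b" "p 3 = c" "p 4 = d" by (simp_all add: p_def)
    have "p ` {1..4} \<subseteq> {1..N}"
      unfolding I using * by (simp add: p[unfolded One_nat_def])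
    moreover have "strict_mono_on {1..4} p"
      unfolding I strict_mono_on_def using * by (auto simp: p[unfolded One_nat_def])
    moreover have "\<forall>a\<in>{1..4}. \<forall>b\<in>{1..4}. \<sigma> (p a) < \<sigma> (p b) \<longleftrightarrow> ?t a < ?t b"
      unfolding I using * by (simp add: p[unfolded One_nat_def] t[unfolded One_nat_def])
    ultimately show ?L
      unfolding contains_pattern_def by blast
  }
qed

text \<open>Pairs of positions are renumbered from 0 to match list indices.\<close>

lemma dumont2_avoiding_2143_iff:
  "\<pi> \<in> dumont2_avoiding n 4 (one_line [2, 1, 4, 3]) \<longleftrightarrow>
     \<pi> permutes {1..2 * n} \<and> (\<forall>i<n. \<pi> (2 * i + 2) \<le> 2 * i + 1 \<and> 2 * i + 1 \<le> \<pi> (2 * i + 1)) \<and>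
     (\<forall>a b c d. 1 \<le> a \<longrightarrow> a < b \<longrightarrow> b < c \<longrightarrow> c < d \<longrightarrow> d \<le> 2 * n \<longrightarrow>
        \<not> (\<pi> b < \<pi> a \<and> \<pi> a < \<pi> d \<and> \<pi> d < \<pi> c))"
proof -
  have "(\<forall>i\<in>{1..n}. \<pi> (2 * i) < 2 * i \<and> \<pi> (2 * i - 1) \<ge> 2 * i - 1) \<longleftrightarrow>
      (\<forall>i<n. \<pi> (2 * i + 2) \<le> 2 * i + 1 \<and> 2 * i + 1 \<le> \<pi> (2 * i + 1))" (is "?L \<longleftrightarrow> ?R")
  proof
    assume L: ?L
    show ?R
    proof (intro allI impI)
      fix i assume "i < n"
      with L have "\<pi> (2 * Suc i) < 2 * Suc i \<and> \<pi> (2 * Suc i - 1) \<ge> 2 * Suc i - 1"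
        by (intro bspec[OF L]) auto
      then show "\<pi> (2 * i + 2) \<le> 2 * i + 1 \<and> 2 * i + 1 \<le> \<pi> (2 * i + 1)" by simp
    qed
  next
    assume R: ?R
    show ?L
    proof
      fix i assume "i \<in> {1..n}"
      then obtain k where "i = Suc k" "k < n" by (cases i) auto
      with R show "\<pi> (2 * i) < 2 * i \<and> \<pi> (2 * i - 1) \<ge> 2 * i - 1" by (simp add: less_Suc_eq_le)
    qed
  qed
  then show ?thesis
    unfolding dumont2_avoiding_def dumont2_def avoids_pattern_def contains_2143_iff
    by blast
qed

section \<open>Separation of the entries at even and odd positions\<close>

text \<open>For \<open>i \<le> j\<close> the Dumont inequalities suffice, with injectivity giving
  strictness. For \<open>j < i\<close> the descents of the pairs \<open>j\<close> and
  \<open>i\<close> would otherwise form a 2143.\<close>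

lemma even_below_odd:
  assumes \<pi>: "\<pi> \<in> dumont2_avoiding n 4 (one_line [2, 1, 4, 3])" and "i < n" "j < n"
  shows "\<pi> (2 * i + 2) < \<pi> (2 * j + 1)"
proof -
  note \<pi>' = \<pi>[unfolded dumont2_avoiding_2143_iff]
  have neq: "\<pi> (2 * k + 2) \<noteq> \<pi> (2 * l + 1)" for k l
  proof -
    have "inj \<pi>" using \<pi>' permutes_inj by blast
    then have "\<pi> (2 * k + 2) = \<pi> (2 * l + 1) \<Longrightarrow> 2 * k + 2 = 2 * l + 1" by (rule injD)
    then show ?thesis by presburger
  qed
  have le: "\<pi> (2 * k + 2) < \<pi> (2 * l + 1)" if "k \<le> l" "l < n" for k l
  proof -
    have "\<pi> (2 * k + 2) \<le> 2 * k + 1" "2 * l + 1 \<le> \<pi> (2 * l + 1)"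
      using \<pi>' that by auto
    with neq[of k l] that show ?thesis by linarith
  qed
  show ?thesis
  proof (cases "i \<le> j")
    case True
    with le assms show ?thesis by blast
  next
    case False
    have "\<not> (\<pi> (2 * j + 2) < \<pi> (2 * j + 1) \<and> \<pi> (2 * j + 1) < \<pi> (2 * i + 2) \<and> \<pi> (2 * i + 2) < \<pi> (2 * i + 1))"
      using \<pi>'[THEN conjunct2, THEN conjunct2, rule_format, of "2 * j + 1" "2 * j + 2" "2 * i + 1" "2 * i + 2"]
        False assms by simp
    with le[of j j] le[of i i] neq[of i j] assms show ?thesis by linarith
  qed
qed

text \<open>Everything from 1 up to an element of \<open>A\<close> lies in \<open>A\<close>, so no
  element of \<open>A\<close> exceeds its cardinality.\<close>

lemma lower_half:
  assumes "A \<union> B = {1..m}" "card A = n" "\<forall>a\<in>A. \<forall>b\<in>B. a < b"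
  shows "A = {1..n}"
proof (rule card_subset_eq)
  have "finite A" using assms(1) by (metis finite_Un finite_atLeastAtMost)
  show "A \<subseteq> {1..n}"
  proof
    fix a assume a: "a \<in> A"
    have "x \<in> A" if "x \<in> {1..a}" for x
    proof -
      have "a \<in> {1..m}" using a assms(1) by blast
      then have "x \<in> A \<union> B" using that assms(1) by simp
      moreover have "x \<notin> B" using bspec[OF bspec[OF assms(3) a], of x] that by auto
      ultimately show ?thesis by blast
    qed
    then have "card {1..a} \<le> card A"
      using \<open>finite A\<close> by (intro card_mono) auto
    then have "a \<le> n" using assms(2) by simp
    moreover have "a \<in> {1..m}" using a assms(1) by blast
    ultimately show "a \<in> {1..n}" by simp
  qed
qed (use assms(2) in auto)

lemma double_interval: "{1..2 * n} = (\<lambda>i. 2 * i + 2) ` {..<n} \<union> (\<lambda>i. 2 * i + 1) ` {..<n :: nat}"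
proof (intro equalityI subsetI)
  fix x assume x: "x \<in> {1..2 * n}"
  show "x \<in> (\<lambda>i. 2 * i + 2) ` {..<n} \<union> (\<lambda>i. 2 * i + 1) ` {..<n}"
  proof (cases "even x")
    case True
    then obtain k where "x = 2 * k" by (elim evenE)
    then show ?thesis using x by (intro UnI1 image_eqI[of _ _ "k - 1"]) auto
  next
    case False
    then obtain k where "x = 2 * k + 1" by (elim oddE)
    then show ?thesis using x by (intro UnI2 image_eqI[of _ _ k]) auto
  qed
qed auto

lemma even_odd_values:
  assumes \<pi>: "\<pi> \<in> dumont2_avoiding n 4 (one_line [2, 1, 4, 3])"
  shows "(\<lambda>i. \<pi> (2 * i + 2)) ` {..<n} = {1..n}"
    and "(\<lambda>i. \<pi> (2 * i + 1)) ` {..<n} = {n + 1..2 * n}"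
proof -
  let ?A = "(\<lambda>i. \<pi> (2 * i + 2)) ` {..<n}" and ?B = "(\<lambda>i. \<pi> (2 * i + 1)) ` {..<n}"
  have perm: "\<pi> permutes {1..2 * n}" using \<pi>[unfolded dumont2_avoiding_2143_iff] by blast
  have union: "?A \<union> ?B = {1..2 * n}"
    using permutes_image[OF perm] unfolding double_interval image_Un image_image .
  have "inj_on (\<lambda>i. \<pi> (2 * i + 2)) {..<n}"
  proof (rule inj_onI)
    fix i j assume "\<pi> (2 * i + 2) = \<pi> (2 * j + 2)"
    then have "2 * i + 2 = 2 * j + 2" by (rule injD[OF permutes_inj[OF perm]])
    then show "i = j" by simp
  qed
  then have "card ?A = n" by (simp add: card_image)
  moreover have below: "\<forall>a\<in>?A. \<forall>b\<in>?B. a < b"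
    using even_below_odd[OF \<pi>] by blast
  ultimately show A: "?A = {1..n}"
    using lower_half[OF union] by blast
  have "?A \<inter> ?B = {}" using below by blast
  then have "?B = {1..2 * n} - {1..n}" using union A by blast
  then show "?B = {n + 1..2 * n}" by auto
qed

text \<open>The entry \<open>n\<close> must precede index \<open>j\<close>, since otherwise
  \<open>xs ! i\<close>, \<open>xs ! j\<close>, \<open>n\<close> would form a 213. Its own bound, at
  an index at most \<open>j - 1\<close>, gives the inequality.\<close>

lemma bounded_213_descent:
  assumes xs: "xs \<in> bounded_213 n d" and "i < j" "j < n" "xs ! j < xs ! i"
  shows "n + 2 \<le> 2 * j + d"
proof -
  note props = xs[unfolded bounded_213_def mem_Collect_eq] and len = bounded_213_length[OF xs]
  have "n \<in> set xs" using props assms by auto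
  then obtain q where q: "q < n" "xs ! q = n" using len by (auto simp: in_set_conv_nth)
  have "xs ! i \<in> set xs" using len assms by simp
  then have i: "xs ! i \<le> n" using props by simp
  have "q < j"
  proof (rule ccontr)
    assume "\<not> q < j"
    moreover have "q \<noteq> j" using assms i q by auto
    ultimately have "j < q" by simp
    moreover have "xs ! i < xs ! q"
    proof -
      have "xs ! i \<noteq> xs ! q"
        using props len q assms \<open>j < q\<close> by (subst nth_eq_iff_index_eq) auto
      then show ?thesis using i q by simp
    qed
    moreover have "\<not> (xs ! j < xs ! i \<and> xs ! i < xs ! q)"
      using avoids_213_iff[THEN iffD1, rule_format, of xs i j q] props len \<open>i < j\<close> \<open>j < q\<close> q(1) by blast
    ultimately show False
      using assms(4) by blast
  qed
  moreover have "n \<le> 2 * q + d" using props q(1) q(2)[symmetric] by simp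
  ultimately show ?thesis by simp
qed

text \<open>
  The components are the entries at the even positions of \<open>\<pi>\<close> and of its reverse complement
  \<open>j \<mapsto> 2 n + 1 - \<pi> (2 n + 1 - j)\<close>; lists are indexed from 0.
\<close>

definition halves :: "nat \<Rightarrow> (nat \<Rightarrow> nat) \<Rightarrow> nat list \<times> nat list" where
  "halves n \<pi> = (map (\<lambda>i. \<pi> (2 * i + 2)) [0..<n],
                 map (\<lambda>i. 2 * n + 1 - \<pi> (2 * (n - 1 - i) + 1)) [0..<n])"

text \<open>The inverse of \<open>halves\<close>: for \<open>j = 2 * i + 1\<close> the index
  \<open>n - 1 - i\<close> undoes the reversal. The identity outside the interval is what
  \<open>permutes\<close> demands.\<close>

definition interleave :: "nat \<Rightarrow> nat list \<times> nat list \<Rightarrow> nat \<Rightarrow> nat" where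
  "interleave n vw j =
     (if j \<notin> {1..2 * n} then j
      else if even j then fst vw ! (j div 2 - 1)
      else 2 * n + 1 - snd vw ! (n - 1 - j div 2))"

lemma interleave_even: "i < n \<Longrightarrow> interleave n (v, w) (2 * i + 2) = v ! i"
  by (simp add: interleave_def)

lemma interleave_odd: "i < n \<Longrightarrow> interleave n (v, w) (2 * i + 1) = 2 * n + 1 - w ! (n - 1 - i)"
  by (simp add: interleave_def)

section \<open>The bijection with pairs of bounded 213-avoiders\<close>

lemma halves_in_bounded_213:
  assumes \<pi>: "\<pi> \<in> dumont2_avoiding n 4 (one_line [2, 1, 4, 3])"
  shows "halves n \<pi> \<in> bounded_213 n 1 \<times> bounded_213 n 2"
proof -
  note \<pi>' = \<pi>[unfolded dumont2_avoiding_2143_iff]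
  note avoid = \<pi>'[THEN conjunct2, THEN conjunct2, rule_format]
  have inj: "inj \<pi>" using \<pi>' permutes_inj by blast
  have "\<pi> (2 * i + 1) \<in> {n + 1..2 * n}" if "i < n" for i
    using that unfolding even_odd_values(2)[OF \<pi>, symmetric] by simp
  then have odd_range: "n + 1 \<le> \<pi> (2 * i + 1)" "\<pi> (2 * i + 1) \<le> 2 * n" if "i < n" for i
    using that by simp_all
  define v where "v = map (\<lambda>i. \<pi> (2 * i + 2)) [0..<n]"
  define w where "w = map (\<lambda>i. 2 * n + 1 - \<pi> (2 * (n - 1 - i) + 1)) [0..<n]"
  have "v \<in> bounded_213 n 1"
  proof -
    have "distinct v"
      by (auto simp: v_def distinct_map inj_eq[OF inj] intro!: inj_onI)
    moreover have "set v = {1..n}"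
      using even_odd_values(1)[OF \<pi>] by (simp add: v_def lessThan_atLeast0)
    moreover have "avoids_213 v"
      unfolding avoids_213_iff
    proof (intro allI impI notI)
      fix i j l assume *: "i < j" "j < l" "l < length v" "v ! j < v ! i \<and> v ! i < v ! l"
      then have "l < n" by (simp add: v_def)
      with * have "\<pi> (2 * j + 2) < \<pi> (2 * i + 2)" "\<pi> (2 * i + 2) < \<pi> (2 * l + 2)"
        by (simp_all add: v_def)
      \<comment> \<open>The entry just before the 3 of the supposed 213 is larger and supplies the 4
        of a 2143.\<close>
      moreover have "\<pi> (2 * l + 2) < \<pi> (2 * l + 1)"
        using even_below_odd[OF \<pi>] \<open>l < n\<close> by blast
      ultimately show False
        using avoid[of "2 * i + 2" "2 * j + 2" "2 * l + 1" "2 * l + 2"] * \<open>l < n\<close> by simp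
    qed
    moreover have "v ! i \<le> 2 * i + 1" if "i < n" for i
      using \<pi>' that by (simp add: v_def)
    ultimately show ?thesis by (simp add: bounded_213_def)
  qed
  moreover have "w \<in> bounded_213 n 2"
  proof -
    have "set w = (\<lambda>y. 2 * n + 1 - y) ` (\<lambda>i. \<pi> (2 * i + 1)) ` (\<lambda>i. n - 1 - i) ` {..<n}"
      by (simp add: w_def image_image lessThan_atLeast0)
    also have "(\<lambda>i. n - 1 - i) ` {..<n} = {..<n}"
    proof (intro equalityI subsetI)
      fix x assume "x \<in> {..<n}"
      then show "x \<in> (\<lambda>i. n - 1 - i) ` {..<n}"
        by (intro image_eqI[of _ _ "n - 1 - x"]) auto
    qed auto
    also have "(\<lambda>y. 2 * n + 1 - y) ` (\<lambda>i. \<pi> (2 * i + 1)) ` {..<n} = {1..n}"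
      unfolding even_odd_values(2)[OF \<pi>]
    proof (intro equalityI subsetI)
      fix x assume "x \<in> {1..n}"
      then show "x \<in> (\<lambda>y. 2 * n + 1 - y) ` {n + 1..2 * n}"
        by (intro image_eqI[of _ _ "2 * n + 1 - x"]) auto
    qed auto
    finally have set_w: "set w = {1..n}" .
    moreover have "length w = n" by (simp add: w_def)
    ultimately have "distinct w" by (intro card_distinct) simp
    moreover have "avoids_213 w"
      unfolding avoids_213_iff
    proof (intro allI impI notI)
      fix i j l assume *: "i < j" "j < l" "l < length w" "w ! j < w ! i \<and> w ! i < w ! l"
      then have "l < n" by (simp add: w_def)
      \<comment> \<open>Undoing the reverse complement turns the 213 in \<open>w\<close> into a 132
        at the odd positions of \<open>\<pi>\<close>, read in the order \<open>l'\<close>,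
        \<open>j'\<close>, \<open>i'\<close>.\<close>
      define i' j' l' where "i' = n - 1 - i" and "j' = n - 1 - j" and "l' = n - 1 - l"
      have less: "l' < j'" "j' < i'" "i' < n"
        using * \<open>l < n\<close> by (auto simp: i'_def j'_def l'_def)
      have "w ! i = 2 * n + 1 - \<pi> (2 * i' + 1)" "w ! j = 2 * n + 1 - \<pi> (2 * j' + 1)"
        "w ! l = 2 * n + 1 - \<pi> (2 * l' + 1)"
        using * \<open>l < n\<close> by (simp_all add: w_def i'_def j'_def l'_def)
      then have "\<pi> (2 * i' + 1) < \<pi> (2 * j' + 1)" "\<pi> (2 * l' + 1) < \<pi> (2 * i' + 1)"
        using *(4) by linarith+
      \<comment> \<open>The even entry right after the first letter of this 132 lies below it and
        supplies the 1 of a 2143.\<close>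
      moreover have "\<pi> (2 * l' + 2) < \<pi> (2 * l' + 1)"
        using even_below_odd[OF \<pi>, of l' l'] less by simp
      ultimately show False
        using avoid[of "2 * l' + 1" "2 * l' + 2" "2 * j' + 1" "2 * i' + 1"] less by simp
    qed
    moreover have "w ! i \<le> 2 * i + 2" if "i < n" for i
    proof -
      have "2 * (n - 1 - i) + 1 \<le> \<pi> (2 * (n - 1 - i) + 1)"
        using \<pi>' that by simp
      then show ?thesis using that by (simp add: w_def)
    qed
    ultimately show ?thesis using set_w by (simp add: bounded_213_def)
  qed
  ultimately show ?thesis by (simp add: halves_def v_def w_def)
qed

text \<open>The threshold \<open>n\<close> separates the values at even and odd positions. An
  occurrence of 2143 thus has its letters 2, 1, 3 at even positions, giving a 213 in
  \<open>v\<close>; or 2, 4, 3 at odd positions, giving a 213 in \<open>w\<close>; or 2, 1 at even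
  and 4, 3 at odd positions, giving a descent in each.\<close>

lemma interleave_in_dumont2:
  assumes v: "v \<in> bounded_213 n 1" and w: "w \<in> bounded_213 n 2"
  shows "interleave n (v, w) \<in> dumont2_avoiding n 4 (one_line [2, 1, 4, 3])"
proof -
  define \<pi> where "\<pi> = interleave n (v, w)"
  note v' = v[unfolded bounded_213_def mem_Collect_eq] and lenv = bounded_213_length[OF v]
  note w' = w[unfolded bounded_213_def mem_Collect_eq] and lenw = bounded_213_length[OF w]
  have v_range: "1 \<le> v ! i" "v ! i \<le> n" and w_range: "1 \<le> w ! i" "w ! i \<le> n" if "i < n" for i
    using nth_mem[of i v] nth_mem[of i w] v' w' lenv lenw that by simp_all
  have even: "\<pi> (2 * i + 2) = v ! i" and odd: "\<pi> (2 * i + 1) = 2 * n + 1 - w ! (n - 1 - i)" if "i < n" for i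
    using that unfolding \<pi>_def by (simp_all only: interleave_even interleave_odd)
  have even_le: "\<pi> (2 * i + 2) \<le> n" and odd_gt: "n < \<pi> (2 * i + 1)" if "i < n" for i
    using v_range[OF that] w_range[of "n - 1 - i"] that by (simp_all only: even odd) auto
  have even_pos: "\<exists>i<n. x = 2 * i + 2" if "1 \<le> x" "x \<le> 2 * n" "\<pi> x \<le> n" for x
  proof -
    have "x \<in> {1..2 * n}" using that by simp
    then consider i where "i < n" "x = 2 * i + 2" | i where "i < n" "x = 2 * i + 1"
      unfolding double_interval by blast
    then show ?thesis using odd_gt that(3) by cases (blast, fastforce)
  qed
  have odd_pos: "\<exists>i<n. x = 2 * i + 1" if "1 \<le> x" "x \<le> 2 * n" "n < \<pi> x" for x
  proof -
    have "x \<in> {1..2 * n}" using that by simp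
    then consider i where "i < n" "x = 2 * i + 2" | i where "i < n" "x = 2 * i + 1"
      unfolding double_interval by blast
    then show ?thesis using even_le that(3) by cases (fastforce, blast)
  qed
  have perm: "\<pi> permutes {1..2 * n}"
  proof (rule bij_imp_permutes)
    have "inj_on \<pi> {1..2 * n}"
    proof (rule inj_onI)
      fix x y assume "x \<in> {1..2 * n}" "y \<in> {1..2 * n}" and eq: "\<pi> x = \<pi> y"
      then have xy: "1 \<le> x" "x \<le> 2 * n" "1 \<le> y" "y \<le> 2 * n" by simp_all
      \<comment> \<open>Equal values lie on the same side of \<open>n\<close>, so their positions
        have the same parity.\<close>
      consider "\<pi> x \<le> n" "\<pi> y \<le> n" | "n < \<pi> x" "n < \<pi> y" using eq by linarith
      then consider i j where "i < n" "j < n" "x = 2 * i + 2" "y = 2 * j + 2"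
        | i j where "i < n" "j < n" "x = 2 * i + 1" "y = 2 * j + 1"
      proof cases
        case 1
        then show ?thesis using even_pos[OF xy(1,2)] even_pos[OF xy(3,4)] that(1) by blast
      next
        case 2
        then show ?thesis using odd_pos[OF xy(1,2)] odd_pos[OF xy(3,4)] that(2) by blast
      qed
      then show "x = y"
      proof cases
        case 1
        then have "v ! i = v ! j" using eq even by simp
        then have "i = j" using 1 v' lenv by (simp add: nth_eq_iff_index_eq)
        then show ?thesis using 1 by simp
      next
        case 2
        then have "2 * n + 1 - w ! (n - 1 - i) = 2 * n + 1 - w ! (n - 1 - j)" using eq odd by simp
        moreover have "w ! (n - 1 - i) \<le> n" "w ! (n - 1 - j) \<le> n"
          using 2 w_range by auto
        ultimately have "w ! (n - 1 - i) = w ! (n - 1 - j)" by linarith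
        then have "n - 1 - i = n - 1 - j" using 2 w' lenw by (simp add: nth_eq_iff_index_eq)
        then show ?thesis using 2 by simp
      qed
    qed
    moreover have "\<pi> ` {1..2 * n} \<subseteq> {1..2 * n}"
    proof -
      have "1 \<le> \<pi> (2 * i + 2)" "\<pi> (2 * i + 2) \<le> 2 * n" "1 \<le> \<pi> (2 * i + 1)" "\<pi> (2 * i + 1) \<le> 2 * n"
        if "i < n" for i
        using v_range[OF that] w_range[of "n - 1 - i"] that by (simp_all only: even odd) auto
      then have range: "\<pi> (2 * i + 2) \<in> {1..2 * n}" "\<pi> (2 * i + 1) \<in> {1..2 * n}" if "i < n" for i
        using that by simp_all
      show ?thesis
      proof (rule image_subsetI)
        fix x assume "x \<in> {1..2 * n}"
        then consider i where "i < n" "x = 2 * i + 2" | i where "i < n" "x = 2 * i + 1"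
          unfolding double_interval by blast
        then show "\<pi> x \<in> {1..2 * n}" using range by cases simp_all
      qed
    qed
    ultimately show "bij_betw \<pi> {1..2 * n} {1..2 * n}"
      unfolding bij_betw_def using endo_inj_surj by blast
  qed (simp add: \<pi>_def interleave_def)
  have dumont: "\<pi> (2 * i + 2) \<le> 2 * i + 1 \<and> 2 * i + 1 \<le> \<pi> (2 * i + 1)" if "i < n" for i
  proof -
    have "w ! (n - 1 - i) \<le> 2 * (n - 1 - i) + 2" using w' that by simp
    moreover have "v ! i \<le> 2 * i + 1" using v' that by simp
    ultimately show ?thesis unfolding even[OF that] odd[OF that] using that by linarith
  qed
  have "\<not> (\<pi> b < \<pi> a \<and> \<pi> a < \<pi> d \<and> \<pi> d < \<pi> c)"
    if ord: "1 \<le> a" "a < b" "b < c" "c < d" "d \<le> 2 * n" for a b c d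
  proof
    assume pat: "\<pi> b < \<pi> a \<and> \<pi> a < \<pi> d \<and> \<pi> d < \<pi> c"
    have range: "1 \<le> a" "a \<le> 2 * n" "1 \<le> b" "b \<le> 2 * n" "1 \<le> c" "c \<le> 2 * n" "1 \<le> d" "d \<le> 2 * n"
      using ord by simp_all
    show False
    proof (cases "\<pi> d \<le> n")
      case True
      then obtain i j l where pos: "a = 2 * i + 2" "b = 2 * j + 2" "d = 2 * l + 2" "l < n"
        using even_pos[of a] even_pos[of b] even_pos[of d] range pat by fastforce
      then have "i < j" "j < l" using ord by simp_all
      moreover have "v ! j < v ! i" "v ! i < v ! l"
        using pat even[of i] even[of j] even[of l] pos \<open>i < j\<close> \<open>j < l\<close> by simp_all
      ultimately show False
        using avoids_213_iff[THEN iffD1, rule_format, of v i j l] v' lenv pos(4) by blast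
    next
      case False
      then obtain k l where pos: "c = 2 * k + 1" "d = 2 * l + 1" "l < n"
        using odd_pos[of c] odd_pos[of d] range pat by fastforce
      then have "k < l" using ord by simp
      define k' l' where "k' = n - 1 - k" and "l' = n - 1 - l"
      have less: "l' < k'" "k' < n" using pos \<open>k < l\<close> by (auto simp: k'_def l'_def)
      have "2 * n + 1 - w ! l' < 2 * n + 1 - w ! k'"
        using pat pos \<open>k < l\<close> odd[of k] odd[of l] unfolding k'_def l'_def by simp
      then have w_desc: "w ! k' < w ! l'" by linarith
      show False
      proof (cases "\<pi> a \<le> n")
        case True
        then obtain i j where pos': "a = 2 * i + 2" "b = 2 * j + 2" "j < n"
          using even_pos[of a] even_pos[of b] range pat by fastforce
        then have "i < j" using ord by simp
        then have "v ! j < v ! i" using pat pos' even[of i] even[of j] by simp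
        \<comment> \<open>The descent in \<open>v\<close> requires \<open>n + 1 \<le> 2 * j\<close>
          and the one in \<open>w\<close> requires \<open>2 * k + 2 \<le> n\<close>, whereas
          \<open>b < c\<close> means \<open>j < k\<close>.\<close>
        then have "n + 2 \<le> 2 * j + 1"
          using bounded_213_descent[OF v \<open>i < j\<close>] pos' by blast
        moreover have "n + 2 \<le> 2 * k' + 2"
          using bounded_213_descent[OF w less w_desc] .
        ultimately show False
          using ord pos pos' \<open>k < l\<close> by (simp add: k'_def)
      next
        case False
        then obtain i where i: "a = 2 * i + 1" "i < n"
          using odd_pos[of a] range by fastforce
        then have "i < k" using ord pos by simp
        define i' where "i' = n - 1 - i"
        have "k' < i'" "i' < n" using \<open>i < k\<close> \<open>k < l\<close> pos by (auto simp: k'_def i'_def)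
        moreover have "2 * n + 1 - w ! i' < 2 * n + 1 - w ! l'"
          using pat pos i odd[of i] odd[of l] unfolding i'_def l'_def by simp
        then have "w ! l' < w ! i'" by linarith
        ultimately show False
          using avoids_213_iff[THEN iffD1, rule_format, of w l' k' i'] w' lenw less w_desc by blast
      qed
    qed
  qed
  with perm dumont show ?thesis
    unfolding dumont2_avoiding_2143_iff \<pi>_def by blast
qed

lemma card_dumont2_avoiding_2143:
  "card (dumont2_avoiding n 4 (one_line [2, 1, 4, 3])) = card (bounded_213 n 1) * card (bounded_213 n 2)"
proof -
  let ?D = "dumont2_avoiding n 4 (one_line [2, 1, 4, 3])"
  have "bij_betw (halves n) ?D (bounded_213 n 1 \<times> bounded_213 n 2)"
  proof (rule bij_betw_byWitness[of _ "interleave n"])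
    show "\<forall>\<pi>\<in>?D. interleave n (halves n \<pi>) = \<pi>"
    proof (intro ballI ext)
      fix \<pi> j assume \<pi>: "\<pi> \<in> ?D"
      then have perm: "\<pi> permutes {1..2 * n}" unfolding dumont2_avoiding_2143_iff by blast
      consider "j \<notin> {1..2 * n}" | i where "i < n" "j = 2 * i + 2" | i where "i < n" "j = 2 * i + 1"
        unfolding double_interval by auto
      then show "interleave n (halves n \<pi>) j = \<pi> j"
      proof cases
        case 1
        then show ?thesis using permutes_not_in[OF perm] by (simp add: interleave_def)
      next
        case 2
        then show ?thesis unfolding halves_def 2(2) by (subst interleave_even) auto
      next
        case 3
        \<comment> \<open>Since \<open>\<pi> j \<le> 2 * n\<close>, complementing twice returns
          \<open>\<pi> j\<close> despite truncated subtraction.\<close>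
        then have "\<pi> j \<in> {1..2 * n}" by (subst permutes_in_image[OF perm]) auto
        with 3 show ?thesis unfolding halves_def 3(2) by (subst interleave_odd) auto
      qed
    qed
    show "\<forall>vw\<in>bounded_213 n 1 \<times> bounded_213 n 2. halves n (interleave n vw) = vw"
    proof (clarify)
      fix v w assume v: "v \<in> bounded_213 n 1" and w: "w \<in> bounded_213 n 2"
      have len: "length v = n" "length w = n" using v w bounded_213_length by auto
      have "w ! i \<le> n" if "i < n" for i
        using w that len nth_mem[of i w] by (simp add: bounded_213_def)
      then have "2 * n + 1 - (2 * n + 1 - w ! i) = w ! i" if "i < n" for i
        using that by fastforce
      then have "map (\<lambda>i. 2 * n + 1 - interleave n (v, w) (2 * (n - 1 - i) + 1)) [0..<n] = w"
        using len by (intro nth_equalityI) (simp_all add: interleave_odd[simplified])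
      moreover have "map (\<lambda>i. interleave n (v, w) (2 * i + 2)) [0..<n] = v"
        using len by (intro nth_equalityI) (simp_all add: interleave_even[simplified])
      ultimately show "halves n (interleave n (v, w)) = (v, w)"
        by (simp add: halves_def)
    qed
    show "halves n ` ?D \<subseteq> bounded_213 n 1 \<times> bounded_213 n 2"
      using halves_in_bounded_213 by blast
    show "interleave n ` (bounded_213 n 1 \<times> bounded_213 n 2) \<subseteq> ?D"
      using interleave_in_dumont2 by auto
  qed
  then show ?thesis
    by (simp add: bij_betw_same_card card_cartesian_product)
qed

theorem theorem3p5:
  fixes n :: nat
  shows "real (card (dumont2_avoiding n 4 (one_line [2, 1, 4, 3]))) = a_seq n * a_seq (n + 1) \<and>
    (\<forall>m::nat.
       a_seq (2 * m) = 1 / real (2 * m + 1) * real ((3 * m) choose m) \<and>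
       a_seq (2 * m + 1) = 1 / real (2 * m + 1) * real ((3 * m + 1) choose (m + 1)) \<and>
       a_seq (2 * m + 1) = 1 / real (m + 1) * real ((3 * m + 1) choose m))"
proof (intro conjI allI)
  show "real (card (dumont2_avoiding n 4 (one_line [2, 1, 4, 3]))) = a_seq n * a_seq (n + 1)"
    using card_bounded_213_1[of n] card_bounded_213_2[of n]
    unfolding card_dumont2_avoiding_2143 by simp
next
  fix m
  show "a_seq (2 * m) = 1 / real (2 * m + 1) * real ((3 * m) choose m)"
    and "a_seq (2 * m + 1) = 1 / real (2 * m + 1) * real ((3 * m + 1) choose (m + 1))"
    by (simp_all add: a_seq_def del: binomial_Suc_Suc)
qed (rule a_seq_odd_alt)

end
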